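(* Let $G$ be an Eulerian digraph. A chip-distribution $x\in\mathbb{Z}^{V(G)}$ is non-terminating if and only if there exist a turnback arc set $T$ of $G$ and a chip-distribution $y\in\mathbb{Z}^{V(G)}$ with $y\geq \mathbf{0}$ such that $x\sim \mathbf{d}^-_T+y$.
   Context: A digraph is a finite directed graph, possibly with multiple edges but without loops; all digraphs are assumed weakly connected. $\overrightarrow{d}(u,v)$ is the number of directed edges from $u$ to $v$; $d^-(v)$, $d^+(v)$ are the indegree and outdegree of $v$ (with multiplicity). $G$ is Eulerian if $d^+(v)=d^-(v)$ for every vertex $v$. Inequalities between vectors are coordinatewise. The Laplacian $L\in\mathbb{Z}^{V(G)\times V(G)}$ is given by $L(u,u)=-d^+(u)$ and $L(u,v)=\overrightarrow{d}(v,u)$ for $u\neq v$. For $x,y\in\mathbb{Z}^{V(G)}$, $x\sim y$ means $x=y+Lz$ for some $z\in\mathbb{Z}^{V(G)}$. A chip-distribution is an element $x\in\mathbb{Z}^{V(G)}$ (negative entries allowed). Firing $v$ replaces $x$ by $x+L\mathbf{1}_v$, where $\mathbf{1}_v$ is the characteristic vector of $v$. A vertex $v$ is active with respect to $x$ if $x(v)\geq d^+(v)$, and firing $v$ is legal if $v$ is active before the firing. A legal game is a sequence of distributions each obtained from the previous one by a legal firing; it terminates when it reaches a distribution with no active vertex. $x$ is terminating if every legal game started from $x$ terminates, and non-terminating if every legal game started from $x$ can be continued indefinitely; by a theorem of Björner and Lovász each $x$ is exactly one of these. A turnback arc set of $G$ is a set $T\subseteq E(G)$ such that reversing all edges of $T$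 in $G$ yields an acyclic digraph (one without directed cycles). For $F\subseteq E(G)$, $\mathbf{d}^-_F\in\mathbb{Z}^{V(G)}$ is its indegree vector: $\mathbf{d}^-_F(v)$ is the number of edges of $F$ with head $v$. *)

theory Defs
  imports "Graph_Theory.Digraph_Component"
begin

text \<open>
  Vectors indexed by the vertices of \<open>G\<close> are functions on the vertex type that vanish outside
  \<open>verts G\<close>, so that equality and addition of vectors are those of functions.  In a well-formed
  digraph the Laplacian has zero entries outside \<open>verts G \<times> verts G\<close>, so \<open>L z\<close> is again such a vector.
\<close>
definition int_vecs :: "('a,'b) pre_digraph \<Rightarrow> ('a \<Rightarrow> int) set" where
  "int_vecs G = {x. \<forall>v. v \<notin> verts G \<longrightarrow> x v = 0}"

definition eulerian :: "('a,'b) pre_digraph \<Rightarrow> bool" where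
  "eulerian G \<longleftrightarrow> (\<forall>v \<in> verts G. out_degree G v = in_degree G v)"

definition arc_mult :: "('a,'b) pre_digraph \<Rightarrow> 'a \<Rightarrow> 'a \<Rightarrow> nat" where
  "arc_mult G u v = card {e \<in> arcs G. tail G e = u \<and> head G e = v}"

definition laplacian :: "('a,'b) pre_digraph \<Rightarrow> 'a \<Rightarrow> 'a \<Rightarrow> int" where
  "laplacian G u v = (if u = v then - int (out_degree G u) else int (arc_mult G v u))"

definition laplacian_mult :: "('a,'b) pre_digraph \<Rightarrow> ('a \<Rightarrow> int) \<Rightarrow> 'a \<Rightarrow> int" where
  "laplacian_mult G z = (\<lambda>u. \<Sum>v\<in>verts G. laplacian G u v * z v)"

definition lin_equiv :: "('a,'b) pre_digraph \<Rightarrow> ('a \<Rightarrow> int) \<Rightarrow> ('a \<Rightarrow> int) \<Rightarrow> bool" where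
  "lin_equiv G x y \<longleftrightarrow> (\<exists>z \<in> int_vecs G. x = (\<lambda>u. y u + laplacian_mult G z u))"

definition active :: "('a,'b) pre_digraph \<Rightarrow> ('a \<Rightarrow> int) \<Rightarrow> 'a \<Rightarrow> bool" where
  "active G x v \<longleftrightarrow> v \<in> verts G \<and> x v \<ge> int (out_degree G v)"

definition fire :: "('a,'b) pre_digraph \<Rightarrow> 'a \<Rightarrow> ('a \<Rightarrow> int) \<Rightarrow> 'a \<Rightarrow> int" where
  "fire G v x = (\<lambda>u. x u + laplacian_mult G (\<lambda>w. if w = v then 1 else 0) u)"

definition legal_firing :: "('a,'b) pre_digraph \<Rightarrow> ('a \<Rightarrow> int) \<Rightarrow> ('a \<Rightarrow> int) \<Rightarrow> bool" where
  "legal_firing G x x' \<longleftrightarrow> (\<exists>v. active G x v \<and> x' = fire G v x)"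

definition legal_game :: "('a,'b) pre_digraph \<Rightarrow> ('a \<Rightarrow> int) list \<Rightarrow> bool" where
  "legal_game G xs \<longleftrightarrow> xs \<noteq> [] \<and> set xs \<subseteq> int_vecs G \<and> successively (legal_firing G) xs"

definition infinite_legal_game :: "('a,'b) pre_digraph \<Rightarrow> (nat \<Rightarrow> 'a \<Rightarrow> int) \<Rightarrow> bool" where
  "infinite_legal_game G f \<longleftrightarrow> range f \<subseteq> int_vecs G \<and> (\<forall>n. legal_firing G (f n) (f (Suc n)))"

definition non_terminating :: "('a,'b) pre_digraph \<Rightarrow> ('a \<Rightarrow> int) \<Rightarrow> bool" where
  "non_terminating G x \<longleftrightarrow>
     (\<forall>xs. legal_game G xs \<and> hd xs = x \<longrightarrow>
        (\<exists>f. infinite_legal_game G f \<and> (\<forall>i < length xs. f i = xs ! i)))"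

definition reverse_arcs :: "('a,'b) pre_digraph \<Rightarrow> 'b set \<Rightarrow> ('a,'b) pre_digraph" where
  "reverse_arcs G T = G\<lparr> tail := (\<lambda>e. if e \<in> T then head G e else tail G e),
                         head := (\<lambda>e. if e \<in> T then tail G e else head G e) \<rparr>"

text \<open>
  \<^const>\<open>pre_digraph.cycle\<close> is a nonempty directed cycle given by its list of arcs; a pair of
  antiparallel arcs forms a cycle of length two.
\<close>
definition acyclic_digraph :: "('a,'b) pre_digraph \<Rightarrow> bool" where
  "acyclic_digraph G \<longleftrightarrow> (\<nexists>p. pre_digraph.cycle G p)"

definition turnback_arc_set :: "('a,'b) pre_digraph \<Rightarrow> 'b set \<Rightarrow> bool" where
  "turnback_arc_set G T \<longleftrightarrow> T \<subseteq> arcs G \<and> acyclic_digraph (reverse_arcs G T)"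

definition indegree_vec :: "('a,'b) pre_digraph \<Rightarrow> 'b set \<Rightarrow> 'a \<Rightarrow> int" where
  "indegree_vec G F = (\<lambda>v. int (card {e \<in> F. head G e = v}))"

end

theory Submission
  imports Defs
begin

text \<open>
  Let \<open>L\<close> be the Laplacian of a connected Eulerian digraph.  The equality of indegrees and outdegrees
  turns \<open>(L z)(u)\<close> into the sum of \<open>z (tail G e) - z u\<close> over the arcs \<open>e\<close> into \<open>u\<close>, and both
  directions of the theorem look at this sum at vertices where \<open>z\<close> is minimal.

  Suppose that \<open>x\<close> is non-terminating, and play an infinite legal game from it.  The number of chips
  is conserved and no vertex becomes more negative than it was initially, so only finitely many
  positions occur and one of them is repeated (\<open>finite_range\<close>).  The firings between two occurrences
  form a nonzero vector in the kernel of \<open>L\<close>, and the kernel consists of the constant vectors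
  (\<open>laplacian_kernel_constant\<close>); hence every vertex fires.  Consider a position reached once every
  vertex has fired, and order the vertices by the time of their last firing so far.  The arcs that
  go from later to earlier vertices form a turnback arc set, and since its own last firing every
  vertex has received a chip along each of these arcs into it (\<open>position_above_turnback\<close>).  So this
  position, which is equivalent to \<open>x\<close>, dominates the indegree vector of the turnback arc set.

  Conversely, every position equivalent to one that dominates the indegree vector of a turnback
  arc set has an active vertex (\<open>active_if_equiv_above_turnback\<close>).  Since legal games stay within an
  equivalence class, none of them gets stuck (\<open>non_terminating_if_all_active\<close>).
\<close>

section \<open>The Laplacian\<close>

lemma laplacian_mult_add:
  "laplacian_mult G (\<lambda>w. f w + g w) v = laplacian_mult G f v + laplacian_mult G g v"
  by (simp add: laplacian_mult_def distrib_left sum.distrib)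

lemma laplacian_mult_uminus:
  "laplacian_mult G (\<lambda>w. - f w) v = - laplacian_mult G f v"
  by (simp add: laplacian_mult_def sum_negf)

locale loopfree_fin_digraph = fin_digraph + loopfree_digraph
begin

lemma arc_mult_self: "arc_mult G u u = 0"
  using no_loops by (fastforce simp: arc_mult_def card_eq_0_iff)

text \<open>
  Grouping the arcs into \<open>u\<close> by their tails turns the row of the Laplacian into a sum over
  single arcs, which can be compared with the arcs of a turnback arc set one by one.
\<close>
lemma laplacian_mult_eq_in_arcs:
  assumes "u \<in> verts G"
  shows "laplacian_mult G z u =
    (\<Sum>e\<in>in_arcs G u. z (tail G e)) - int (out_degree G u) * z u"
proof -
  have "laplacian G u v * z v =
      int (arc_mult G v u) * z v - (if v = u then int (out_degree G u) * z u else 0)" for v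
    by (simp add: laplacian_def arc_mult_self)
  then have "laplacian_mult G z u =
      (\<Sum>v\<in>verts G. int (arc_mult G v u) * z v) - int (out_degree G u) * z u"
    using assms by (simp add: laplacian_mult_def sum_subtractf)
  also have "(\<Sum>v\<in>verts G. int (arc_mult G v u) * z v) =
      (\<Sum>v\<in>verts G. \<Sum>e\<in>{e \<in> in_arcs G u. tail G e = v}. z (tail G e))"
  proof (rule sum.cong[OF refl])
    fix v
    have "{e \<in> arcs G. tail G e = v \<and> head G e = u} = {e \<in> in_arcs G u. tail G e = v}"
      by auto
    then show "int (arc_mult G v u) * z v =
        (\<Sum>e\<in>{e \<in> in_arcs G u. tail G e = v}. z (tail G e))"
      by (simp add: arc_mult_def)
  qed
  also have "\<dots> = (\<Sum>e\<in>in_arcs G u. z (tail G e))"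
    by (rule sum.group) (auto simp: finite_in_arcs)
  finally show ?thesis .
qed

lemma laplacian_mult_outside: "laplacian_mult G z u = 0" if "u \<notin> verts G"
proof -
  have "laplacian G u v = 0" if "v \<in> verts G" for v
  proof -
    have "{e \<in> arcs G. tail G e = v \<and> head G e = u} = {}"
      using \<open>u \<notin> verts G\<close> by auto
    moreover have "u \<noteq> v"
      using \<open>u \<notin> verts G\<close> that by auto
    ultimately show ?thesis
      by (simp add: laplacian_def arc_mult_def del: Collect_empty_eq)
  qed
  then show ?thesis by (simp add: laplacian_mult_def)
qed

text \<open>Firing conserves the number of chips: each column of the Laplacian sums to zero.\<close>
lemma sum_laplacian_mult: "(\<Sum>u\<in>verts G. laplacian_mult G z u) = 0"
proof -
  have "(\<Sum>u\<in>verts G. \<Sum>e\<in>in_arcs G u. z (tail G e)) = (\<Sum>e\<in>arcs G. z (tail G e))"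
    unfolding in_arcs_def by (rule sum.group) auto
  moreover have "(\<Sum>u\<in>verts G. int (out_degree G u) * z u) =
      (\<Sum>u\<in>verts G. \<Sum>e\<in>out_arcs G u. z (tail G e))"
    by (simp add: out_degree_def)
  moreover have "(\<Sum>u\<in>verts G. \<Sum>e\<in>out_arcs G u. z (tail G e)) = (\<Sum>e\<in>arcs G. z (tail G e))"
    unfolding out_arcs_def by (rule sum.group) auto
  ultimately show ?thesis
    by (simp add: laplacian_mult_eq_in_arcs sum_subtractf)
qed

lemma fire_eq:
  assumes "u \<in> verts G"
  shows "fire G v x u =
    (if u = v then x u - int (out_degree G u) else x u + int (arc_mult G v u))"
proof -
  have "in_arcs G u \<inter> {e. tail G e = v} = {e \<in> arcs G. tail G e = v \<and> head G e = u}"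
    by auto
  then have "(\<Sum>e\<in>in_arcs G u. if tail G e = v then 1 else 0) = int (arc_mult G v u)"
    by (simp add: finite_in_arcs sum.If_cases arc_mult_def)
  then show ?thesis
    using assms by (auto simp: fire_def laplacian_mult_eq_in_arcs arc_mult_self)
qed


section \<open>Linear equivalence and legal games\<close>

lemma lin_equiv_refl: "lin_equiv G x x"
  unfolding lin_equiv_def
  by (rule bexI[of _ "\<lambda>_. 0"]) (auto simp: laplacian_mult_def int_vecs_def)

lemma lin_equiv_sym: "lin_equiv G x y \<Longrightarrow> lin_equiv G y x"
  unfolding lin_equiv_def
  by (erule bexE, rule_tac x = "\<lambda>w. - z w" in bexI) (auto simp: laplacian_mult_uminus int_vecs_def)

lemma lin_equiv_trans: "lin_equiv G x y \<Longrightarrow> lin_equiv G y w \<Longrightarrow> lin_equiv G x w"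
  unfolding lin_equiv_def
  by (elim bexE, rule_tac x = "\<lambda>v. z v + za v" in bexI)
    (auto simp: laplacian_mult_add int_vecs_def)

lemma lin_equiv_fire: "v \<in> verts G \<Longrightarrow> lin_equiv G (fire G v x) x"
  unfolding lin_equiv_def fire_def by (rule bexI, rule refl) (auto simp: int_vecs_def)

lemma legal_firing_lin_equiv: "legal_firing G x x' \<Longrightarrow> lin_equiv G x' x"
  by (auto simp: legal_firing_def active_def intro: lin_equiv_fire)

lemma lin_equiv_int_vecs: "lin_equiv G x y \<Longrightarrow> y \<in> int_vecs G \<Longrightarrow> x \<in> int_vecs G"
  by (auto simp: lin_equiv_def int_vecs_def laplacian_mult_outside)

lemma successively_lin_equiv:
  "successively (legal_firing G) xs \<Longrightarrow> xs \<noteq> [] \<Longrightarrow> lin_equiv G (last xs) (hd xs)"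
proof (induction xs rule: induct_list012)
  case (3 x y zs)
  then show ?case
    by (auto intro: lin_equiv_trans legal_firing_lin_equiv)
qed (auto intro: lin_equiv_refl)

text \<open>
  A legal game never leaves the equivalence class of its initial position, so it cannot get stuck
  if no position in that class is stable.  This is how non-termination, a statement about every
  legal game from \<open>x\<close>, is reduced to a statement about single positions.
\<close>
lemma non_terminating_if_all_active:
  assumes "x \<in> int_vecs G"
    and act: "\<And>x'. lin_equiv G x' x \<Longrightarrow> \<exists>v. active G x' v"
  shows "non_terminating G x"
  unfolding non_terminating_def
proof (intro allI impI)
  fix xs assume game: "legal_game G xs \<and> hd xs = x"
  then have xs: "xs \<noteq> []" "set xs \<subseteq> int_vecs G" "successively (legal_firing G) xs" "hd xs = x"
    by (auto simp: legal_game_def)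
  have "lin_equiv G (last xs) x"
    using successively_lin_equiv xs by blast
  define step where "step y = fire G (SOME v. active G y v) y" for y
  have step: "legal_firing G y (step y)" if "lin_equiv G y x" for y
    unfolding legal_firing_def step_def using someI_ex[OF act[OF that]] by blast
  define g where "g n = (step ^^ n) (last xs)" for n
  have g_equiv: "lin_equiv G (g n) x" for n
  proof (induction n)
    case 0
    show ?case using \<open>lin_equiv G (last xs) x\<close> by (simp add: g_def)
  next
    case (Suc n)
    then have "lin_equiv G (g (Suc n)) (g n)"
      using legal_firing_lin_equiv[OF step] by (simp add: g_def)
    then show ?case using Suc lin_equiv_trans by blast
  qed
  then have g_step: "legal_firing G (g n) (g (Suc n))" for n
    using step[OF g_equiv[of n]] by (simp add: g_def)
  \<comment> \<open>The first position of \<open>g\<close> is the last one of \<open>xs\<close>, which is why the two overlap by one.\<close>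
  define f where "f n = (if n < length xs then xs ! n else g (n - (length xs - 1)))" for n
  have f_late: "f n = g (n - (length xs - 1))" if "n \<ge> length xs - 1" for n
  proof (cases "n < length xs")
    case True
    then have "n = length xs - 1" using that by simp
    then show ?thesis using True xs(1) by (simp add: f_def g_def last_conv_nth)
  qed (simp add: f_def)
  have "legal_firing G (f n) (f (Suc n))" for n
  proof (cases "Suc n < length xs")
    case True
    then show ?thesis
      using xs(3) by (simp add: f_def successively_conv_nth)
  next
    case False
    then have "Suc n - (length xs - 1) = Suc (n - (length xs - 1))" "n \<ge> length xs - 1"
      using xs(1) by (auto simp: Suc_diff_le)
    then show ?thesis using g_step by (simp add: f_late)
  qed
  moreover have "f n \<in> int_vecs G" for n
    using xs(2) lin_equiv_int_vecs[OF g_equiv assms(1)] by (auto simp: f_def)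
  ultimately have "infinite_legal_game G f"
    by (auto simp: infinite_legal_game_def)
  then show "\<exists>f. infinite_legal_game G f \<and> (\<forall>i<length xs. f i = xs ! i)"
    by (intro exI[of _ f]) (auto simp: f_def)
qed

end


section \<open>Connected Eulerian digraphs\<close>

locale connected_eulerian_digraph = loopfree_fin_digraph +
  assumes connected: "Digraph_Component.connected G" and eulerian: "eulerian G"
begin

lemma verts_nonempty: "verts G \<noteq> {}"
  using connected by (simp add: connected_def strongly_connected_def)

lemma ex_minimum:
  fixes z :: "'a \<Rightarrow> int"
  obtains m where "\<And>v. v \<in> verts G \<Longrightarrow> m \<le> z v" "{v \<in> verts G. z v = m} \<noteq> {}"
proof (rule that)
  show "Min (z ` verts G) \<le> z v" if "v \<in> verts G" for v
    using that by simp
  have "Min (z ` verts G) \<in> z ` verts G"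
    using verts_nonempty by (intro Min_in) auto
  then show "{v \<in> verts G. z v = Min (z ` verts G)} \<noteq> {}" by auto
qed

text \<open>
  Counting arcs with their head in \<open>S\<close> by indegrees, and arcs with their tail in \<open>S\<close> by
  outdegrees, gives the same number.  Since the first set of arcs is contained in the second, they
  are equal: no arc leaves \<open>S\<close> either, and weak connectedness does the rest.
\<close>
lemma in_closed_eq_verts:
  assumes "S \<subseteq> verts G" "S \<noteq> {}"
    and closed: "\<And>e. e \<in> arcs G \<Longrightarrow> head G e \<in> S \<Longrightarrow> tail G e \<in> S"
  shows "S = verts G"
proof -
  have fin: "finite S" using assms(1) finite_verts by (rule finite_subset)
  have "card {e \<in> arcs G. head G e \<in> S} = (\<Sum>v\<in>S. in_degree G v)"
  proof -
    have "{e \<in> arcs G. head G e \<in> S} = (\<Union>v\<in>S. in_arcs G v)" by auto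
    then show ?thesis
      using fin by (simp add: in_degree_def card_UN_disjoint finite_in_arcs disjoint_iff)
  qed
  also have "\<dots> = (\<Sum>v\<in>S. out_degree G v)"
    using assms(1) eulerian by (intro sum.cong) (auto simp: eulerian_def)
  also have "\<dots> = card {e \<in> arcs G. tail G e \<in> S}"
  proof -
    have "{e \<in> arcs G. tail G e \<in> S} = (\<Union>v\<in>S. out_arcs G v)" by auto
    then show ?thesis
      using fin by (simp add: out_degree_def card_UN_disjoint finite_out_arcs disjoint_iff)
  qed
  finally have "{e \<in> arcs G. head G e \<in> S} = {e \<in> arcs G. tail G e \<in> S}"
    using closed by (intro card_subset_eq) auto
  then have out_closed: "head G e \<in> S" if "e \<in> arcs G" "tail G e \<in> S" for e
    using that by blast
  interpret sym: pair_wf_digraph "mk_symmetric G" by (rule wellformed_mk_symmetric)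
  obtain u where "u \<in> S" using assms(2) by auto
  have "v \<in> S" if "v \<in> verts G" for v
  proof -
    have "u \<rightarrow>\<^sup>*\<^bsub>mk_symmetric G\<^esub> v"
      using connected \<open>u \<in> S\<close> assms(1) that
      by (auto simp: connected_def strongly_connected_def)
    then show ?thesis
    proof (induction rule: sym.reachable_induct)
      case (step x y)
      then show ?case
        using closed out_closed by (auto simp: parcs_mk_symmetric)
    qed (rule \<open>u \<in> S\<close>)
  qed
  with assms(1) show ?thesis by auto
qed

lemma laplacian_mult_eq_differences:
  assumes "u \<in> verts G"
  shows "laplacian_mult G z u = (\<Sum>e\<in>in_arcs G u. z (tail G e) - z u)"
  using assms eulerian
  by (simp add: laplacian_mult_eq_in_arcs eulerian_def in_degree_def sum_subtractf)

text \<open>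
  A minimum principle: at a vertex where \<open>z\<close> is minimal, \<open>L z\<close> is a sum of nonnegative differences.
  If it vanishes, then \<open>z\<close> is minimal at every in-neighbour as well, and so everywhere.
\<close>
lemma laplacian_kernel_constant:
  assumes ker: "\<And>v. v \<in> verts G \<Longrightarrow> laplacian_mult G z v = 0"
    and "u \<in> verts G" "v \<in> verts G"
  shows "z u = z v"
proof -
  obtain m where le: "\<And>v. v \<in> verts G \<Longrightarrow> m \<le> z v" and ne: "{v \<in> verts G. z v = m} \<noteq> {}"
    by (rule ex_minimum[of z]) blast
  define M where "M = {v \<in> verts G. z v = m}"
  have "M \<noteq> {}" using ne unfolding M_def .
  moreover have "tail G e \<in> M" if e: "e \<in> arcs G" "head G e \<in> M" for e
  proof -
    have "(\<Sum>a\<in>in_arcs G (head G e). z (tail G a) - m) = 0"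
      using ker[of "head G e"] laplacian_mult_eq_differences[of "head G e" z] e
      by (simp add: M_def)
    then have "\<forall>a\<in>in_arcs G (head G e). z (tail G a) - m = 0"
      by (subst (asm) sum_nonneg_eq_0_iff) (auto simp: le finite_in_arcs)
    then show ?thesis using e by (auto simp: M_def)
  qed
  ultimately have "M = verts G"
    by (intro in_closed_eq_verts) (auto simp: M_def)
  then have "u \<in> M" "v \<in> M" using assms(2,3) by simp_all
  then show ?thesis by (simp add: M_def)
qed

end


section \<open>Turnback arc sets and acyclic orders\<close>

lemma (in wf_digraph) acyclic_digraph_iff: "acyclic_digraph G \<longleftrightarrow> acyclic (arcs_ends G)"
proof
  assume "acyclic_digraph G"
  then show "acyclic (arcs_ends G)"
    unfolding acyclic_def acyclic_digraph_def
    using closed_w_imp_cycle by (fastforce simp: reachable1_awalk closed_w_def)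
next
  assume "acyclic (arcs_ends G)"
  then show "acyclic_digraph G"
    unfolding acyclic_def acyclic_digraph_def
    by (auto simp: reachable1_awalk cycle_def)
qed

text \<open>
  The arcs are replaced here by pairs of vertices, so that well-founded relations on the vertices
  become applicable in place of walks in the reversed digraph.
\<close>
lemma (in wf_digraph) turnback_arc_set_iff:
  "turnback_arc_set G T \<longleftrightarrow> T \<subseteq> arcs G \<and>
    acyclic ((\<lambda>e. if e \<in> T then (head G e, tail G e) else (tail G e, head G e)) ` arcs G)"
proof -
  interpret R: wf_digraph "reverse_arcs G T"
    by unfold_locales (auto simp: reverse_arcs_def)
  have "arcs_ends (reverse_arcs G T) =
      (\<lambda>e. if e \<in> T then (head G e, tail G e) else (tail G e, head G e)) ` arcs G"
    unfolding arcs_ends_conv by (rule image_cong) (auto simp: reverse_arcs_def)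
  then show ?thesis
    by (simp add: turnback_arc_set_def R.acyclic_digraph_iff)
qed

context connected_eulerian_digraph
begin

text \<open>
  Write \<open>x = d + y + L z\<close>, where \<open>d\<close> is the indegree vector of \<open>T\<close>.  Among the vertices where \<open>z\<close>
  is minimal, choose \<open>v\<close> without a predecessor among them in the digraph obtained by reversing \<open>T\<close>.
  Then every arc \<open>e\<close> into \<open>v\<close> contributes at least \<open>1\<close> to \<open>x v\<close>: an arc of \<open>T\<close> through \<open>d v\<close>, and
  any other arc through the summand \<open>z (tail G e) - z v\<close> of \<open>L z\<close>, which is positive because the
  tail of \<open>e\<close> precedes \<open>v\<close>.  Hence \<open>x v\<close> is at least the indegree of \<open>v\<close>, which is its outdegree.
\<close>
lemma active_if_equiv_above_turnback:
  assumes T: "turnback_arc_set G T"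
    and y: "\<And>v. v \<in> verts G \<Longrightarrow> y v \<ge> 0"
    and equiv: "lin_equiv G x (\<lambda>v. indegree_vec G T v + y v)"
  shows "\<exists>v. active G x v"
proof -
  obtain z where x: "x = (\<lambda>v. indegree_vec G T v + y v + laplacian_mult G z v)"
    using equiv by (auto simp: lin_equiv_def)
  define r where
    "r = (\<lambda>e. if e \<in> T then (head G e, tail G e) else (tail G e, head G e)) ` arcs G"
  have "T \<subseteq> arcs G" and "acyclic r"
    using T by (auto simp: turnback_arc_set_iff r_def)
  then have "wf r"
    by (intro finite_acyclic_wf) (auto simp: r_def)
  obtain m where le: "\<And>v. v \<in> verts G \<Longrightarrow> m \<le> z v" and ne: "{v \<in> verts G. z v = m} \<noteq> {}"
    by (rule ex_minimum[of z]) blast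
  define M where "M = {v \<in> verts G. z v = m}"
  have "M \<noteq> {}" using ne unfolding M_def .
  then obtain v where "v \<in> M" and min: "\<And>u. (u, v) \<in> r \<Longrightarrow> u \<notin> M"
    using \<open>wf r\<close> by (metis wf_eq_minimal ex_in_conv)
  then have v: "v \<in> verts G" "z v = m" by (auto simp: M_def)
  have "int (out_degree G v) = (\<Sum>e\<in>in_arcs G v. 1)"
    using eulerian v(1) by (simp add: eulerian_def in_degree_def)
  also have "\<dots> \<le> (\<Sum>e\<in>in_arcs G v. (if e \<in> T then 1 else 0) + (z (tail G e) - z v))"
  proof (rule sum_mono)
    fix e assume e: "e \<in> in_arcs G v"
    show "1 \<le> (if e \<in> T then 1 else 0) + (z (tail G e) - z v)"
    proof (cases "e \<in> T")
      case True
      then show ?thesis using e le[of "tail G e"] v(2) by simp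
    next
      case False
      then have "(tail G e, v) \<in> r" using e by (force simp: r_def)
      then have "tail G e \<notin> M" by (rule min)
      then have "z (tail G e) \<noteq> m" using e by (simp add: M_def)
      then show ?thesis using False e le[of "tail G e"] v(2) by simp
    qed
  qed
  also have "\<dots> = (\<Sum>e\<in>in_arcs G v. if e \<in> T then 1 else 0) + laplacian_mult G z v"
    using v(1) by (simp add: sum.distrib laplacian_mult_eq_differences)
  also have "(\<Sum>e\<in>in_arcs G v. if e \<in> T then 1 else 0) = indegree_vec G T v"
  proof -
    have "in_arcs G v \<inter> T = {e \<in> T. head G e = v}" using \<open>T \<subseteq> arcs G\<close> by auto
    then show ?thesis
      by (simp add: sum.If_cases finite_in_arcs indegree_vec_def)
  qed
  also have "\<dots> + laplacian_mult G z v \<le> x v"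
    using y[OF v(1)] by (simp add: x)
  finally show ?thesis using v(1) by (auto simp: active_def)
qed

end

section \<open>Infinite legal games\<close>

text \<open>
  An infinite legal game from \<open>f 0\<close> in which the vertex \<open>c n\<close> is fired at time \<open>n\<close>.  The proof
  counts firings and compares their times, and so needs the vertices as well as the positions.
\<close>
locale infinite_firing = connected_eulerian_digraph +
  fixes f :: "nat \<Rightarrow> 'a \<Rightarrow> int" and c :: "nat \<Rightarrow> 'a"
  assumes int_vecs: "f n \<in> int_vecs G"
    and active: "active G (f n) (c n)"
    and step: "f (Suc n) = fire G (c n) (f n)"
begin

lemma c_in_verts: "c n \<in> verts G"
  using active by (simp add: active_def)

text \<open>Only firing \<open>v\<close> removes chips from \<open>v\<close>, and a legal firing cannot make it negative.\<close>
lemma lower_bound: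
  assumes "v \<in> verts G"
  shows "min 0 (f 0 v) \<le> f n v"
proof (induction n)
  case (Suc n)
  then show ?case
    using active[of n] assms by (auto simp: step fire_eq active_def)
qed simp

lemma sum_chips: "(\<Sum>v\<in>verts G. f n v) = (\<Sum>v\<in>verts G. f 0 v)"
  by (induction n) (simp_all add: step fire_def sum.distrib sum_laplacian_mult)

text \<open>
  With the total number of chips fixed, a lower bound on all vertices also gives an upper bound.
\<close>
lemma finite_range: "finite (range f)"
proof -
  define B where "B = (\<Sum>v\<in>verts G. \<bar>f 0 v\<bar>)"
  have B: "\<bar>f 0 v\<bar> \<le> B" if "v \<in> verts G" for v
    unfolding B_def using that by (intro member_le_sum) auto
  define C where "C = B + int (card (verts G)) * B"
  have "f n v \<in> {-B..C}" if v: "v \<in> verts G" for n v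
  proof -
    have lower: "- B \<le> f n w" if "w \<in> verts G" for w
      using lower_bound[OF that, of n] B[OF that] by linarith
    have "f n v + B \<le> (\<Sum>w\<in>verts G. f n w + B)"
    proof (rule member_le_sum[OF v])
      show "0 \<le> f n w + B" if "w \<in> verts G - {v}" for w
        using lower[of w] that by simp
    qed simp
    also have "\<dots> = (\<Sum>w\<in>verts G. f 0 w) + int (card (verts G)) * B"
      by (simp add: sum.distrib sum_chips[of n])
    also have "(\<Sum>w\<in>verts G. f 0 w) \<le> B"
      unfolding B_def by (intro sum_mono) auto
    finally have "f n v + B \<le> C" by (simp add: C_def)
    moreover have "0 \<le> B" using B[OF v] by linarith
    ultimately show ?thesis using lower[OF v] by simp
  qed
  then have "range f \<subseteq> {h. \<forall>v. (v \<in> verts G \<longrightarrow> h v \<in> {-B..C}) \<and> (v \<notin> verts G \<longrightarrow> h v = 0)}"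
    using int_vecs by (auto simp: int_vecs_def)
  then show ?thesis
    by (rule finite_subset) (intro finite_set_of_finite_funs finite_verts finite_atLeastAtMost_int)
qed

definition fired :: "nat \<Rightarrow> nat \<Rightarrow> 'a \<Rightarrow> nat" where
  "fired i j v = card {t \<in> {i..<j}. c t = v}"

lemma position_diff:
  "i \<le> j \<Longrightarrow> f j v = f i v + laplacian_mult G (\<lambda>w. int (fired i j w)) v"
proof (induction j rule: dec_induct)
  case base
  show ?case by (simp add: fired_def laplacian_mult_def)
next
  case (step j)
  have "{t \<in> {i..<Suc j}. c t = w} =
      (if w = c j then insert j {t \<in> {i..<j}. c t = w} else {t \<in> {i..<j}. c t = w})" for w
    using step.hyps by (auto simp: less_Suc_eq)
  then have "(\<lambda>w. int (fired i (Suc j) w)) = (\<lambda>w. int (fired i j w) + (if w = c j then 1 else 0))"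
    by (auto simp: fired_def)
  then show ?case
    using step.IH by (simp add: infinite_firing.step[OF infinite_firing_axioms] fire_def
        laplacian_mult_add)
qed

lemma lin_equiv_initial: "lin_equiv G (f n) (f 0)"
proof (induction n)
  case (Suc n)
  then show ?case using lin_equiv_fire[OF c_in_verts] lin_equiv_trans step by metis
qed (rule lin_equiv_refl)

text \<open>
  Two positions of the game coincide, as there are only finitely many.  The numbers of firings
  between them form a vector in the kernel of \<open>L\<close>, which is constant and nonzero.
\<close>
lemma ex_period_firing_all:
  obtains i j where "i < j" and "\<And>v. v \<in> verts G \<Longrightarrow> \<exists>t\<in>{i..<j}. c t = v"
proof -
  have "\<not> inj f"
    using finite_range infinite_UNIV_nat finite_imageD by blast
  then obtain i j where ij: "i < j" "f i = f j"
    by (metis injI linorder_neqE_nat)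
  have ker: "laplacian_mult G (\<lambda>w. int (fired i j w)) v = 0" for v
    using position_diff[of i j v] ij by simp
  have "i \<in> {t \<in> {i..<j}. c t = c i}" using ij(1) by simp
  then have "fired i j (c i) \<noteq> 0"
    unfolding fired_def by (subst card_eq_0_iff) auto
  moreover have "fired i j v = fired i j (c i)" if "v \<in> verts G" for v
    using laplacian_kernel_constant[OF ker that c_in_verts] by simp
  ultimately have "fired i j v \<noteq> 0" if "v \<in> verts G" for v
    using that by simp
  then have "\<exists>t\<in>{i..<j}. c t = v" if "v \<in> verts G" for v
    using that by (fastforce simp: fired_def card_eq_0_iff)
  with ij(1) show ?thesis using that by blast
qed

text \<open>
  Let \<open>l v\<close> be the time of the last firing of \<open>v\<close> before a time by which all vertices have fired,
  and let \<open>T\<close> consist of the arcs whose tail fired last after their head did.  After the reversal of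
  \<open>T\<close> all arcs go from smaller to larger values of \<open>l\<close>.  A vertex \<open>v\<close> is left with a nonnegative
  number of chips by its own last firing, and afterwards it only gains chips, among them one along
  each arc of \<open>T\<close> with head \<open>v\<close>.
\<close>
lemma position_above_turnback:
  obtains n T where "turnback_arc_set G T" "\<And>v. v \<in> verts G \<Longrightarrow> indegree_vec G T v \<le> f n v"
proof -
  obtain i j where ij: "i < j" "\<And>v. v \<in> verts G \<Longrightarrow> \<exists>t\<in>{i..<j}. c t = v"
    by (rule ex_period_firing_all) blast
  define l where "l v = Max {t \<in> {i..<j}. c t = v}" for v
  have l: "l v < j" "c (l v) = v" if "v \<in> verts G" for v
  proof -
    have "l v \<in> {t \<in> {i..<j}. c t = v}"
      unfolding l_def using ij(2)[OF that] by (intro Max_in) auto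
    then show "l v < j" "c (l v) = v" by auto
  qed
  have l_last: "c t \<noteq> v" if "v \<in> verts G" "l v < t" "t < j" for t v
  proof
    assume "c t = v"
    obtain s where "s \<in> {i..<j}" "c s = v" using ij(2)[OF \<open>v \<in> verts G\<close>] by blast
    then have "s \<le> l v" unfolding l_def by (intro Max_ge) auto
    then have "t \<in> {t \<in> {i..<j}. c t = v}"
      using \<open>s \<in> {i..<j}\<close> that \<open>c t = v\<close> by auto
    then have "t \<le> l v" unfolding l_def by (intro Max_ge) auto
    then show False using that by simp
  qed
  define T where "T = {e \<in> arcs G. l (head G e) < l (tail G e)}"
  have "l (tail G e) \<noteq> l (head G e)" if "e \<in> arcs G" for e
    using l(2) no_loops that by (metis head_in_verts tail_in_verts)
  then have "(\<lambda>e. if e \<in> T then (head G e, tail G e) else (tail G e, head G e)) ` arcs G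
      \<subseteq> measure l"
    by (fastforce simp: T_def)
  then have "acyclic ((\<lambda>e. if e \<in> T then (head G e, tail G e) else (tail G e, head G e)) ` arcs G)"
    by (rule acyclic_subset[OF wf_acyclic[OF wf_measure]])
  then have "turnback_arc_set G T"
    unfolding turnback_arc_set_iff by (auto simp: T_def)
  moreover have "indegree_vec G T v \<le> f j v" if v: "v \<in> verts G" for v
  proof -
    have gain: "(\<Sum>t\<in>{Suc (l v)..<n}. int (arc_mult G (c t) v)) \<le> f n v"
      if "Suc (l v) \<le> n" "n \<le> j" for n
      using that
    proof (induction n rule: dec_induct)
      case base
      have "active G (f (l v)) v" using active[of "l v"] l(2)[OF v] by simp
      then show ?case using v l(2)[OF v] by (simp add: step fire_eq active_def)
    next
      case (step n)
      then have "c n \<noteq> v" using l_last[OF v, of n] by simp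
      then show ?case
        using step v infinite_firing.step[OF infinite_firing_axioms, of n]
        by (simp add: fire_eq)
    qed
    have sub: "{e \<in> T. head G e = v}
        \<subseteq> (\<Union>t\<in>{Suc (l v)..<j}. {e \<in> arcs G. tail G e = c t \<and> head G e = v})"
    proof
      fix e assume "e \<in> {e \<in> T. head G e = v}"
      then have "e \<in> arcs G" "head G e = v" "l v < l (tail G e)" by (auto simp: T_def)
      then show "e \<in> (\<Union>t\<in>{Suc (l v)..<j}. {e \<in> arcs G. tail G e = c t \<and> head G e = v})"
        using l[of "tail G e"] by (intro UN_I[of "l (tail G e)"]) auto
    qed
    have "card {e \<in> T. head G e = v}
        \<le> card (\<Union>t\<in>{Suc (l v)..<j}. {e \<in> arcs G. tail G e = c t \<and> head G e = v})"
      using sub by (rule card_mono[rotated]) auto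
    also have "\<dots> \<le> (\<Sum>t\<in>{Suc (l v)..<j}. arc_mult G (c t) v)"
      unfolding arc_mult_def by (rule card_UN_le) simp
    finally have "indegree_vec G T v \<le> (\<Sum>t\<in>{Suc (l v)..<j}. int (arc_mult G (c t) v))"
      by (simp add: indegree_vec_def flip: of_nat_sum)
    also have "\<dots> \<le> f j v"
      using gain[of j] l(1)[OF v] by simp
    finally show ?thesis .
  qed
  ultimately show ?thesis by (rule that)
qed

end

section \<open>The characterisation\<close>

lemma (in connected_eulerian_digraph) infinite_game_imp_above_turnback:
  assumes "infinite_legal_game G f"
  shows "\<exists>T. turnback_arc_set G T \<and> (\<exists>y \<in> int_vecs G. (\<forall>v \<in> verts G. y v \<ge> 0) \<and>
    lin_equiv G (f 0) (\<lambda>v. indegree_vec G T v + y v))"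
proof -
  have "\<exists>v. active G (f n) v \<and> f (Suc n) = fire G v (f n)" for n
    using assms by (simp add: infinite_legal_game_def legal_firing_def)
  then obtain c where "\<And>n. active G (f n) (c n) \<and> f (Suc n) = fire G (c n) (f n)" by metis
  then interpret infinite_firing G f c
    using assms by unfold_locales (auto simp: infinite_legal_game_def)
  obtain n T where T: "turnback_arc_set G T"
    and ge: "\<And>v. v \<in> verts G \<Longrightarrow> indegree_vec G T v \<le> f n v"
    by (rule position_above_turnback) blast
  have "{e \<in> T. head G e = v} = {}" if "v \<notin> verts G" for v
    using T that by (auto simp: turnback_arc_set_def)
  then have "(\<lambda>v. f n v - indegree_vec G T v) \<in> int_vecs G"
    using int_vecs[of n] by (simp add: int_vecs_def indegree_vec_def del: Collect_empty_eq)
  then show ?thesis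
    using T ge lin_equiv_sym[OF lin_equiv_initial[of n]]
    by (intro exI[of _ T] conjI bexI[of _ "\<lambda>v. f n v - indegree_vec G T v"]) auto
qed

theorem theorem3p8:
  fixes G :: "('a,'b) pre_digraph" and x :: "'a \<Rightarrow> int"
  assumes "fin_digraph G" and "loopfree_digraph G" and "Digraph_Component.connected G"
    and "eulerian G"
    and "x \<in> int_vecs G"
  shows "non_terminating G x \<longleftrightarrow>
    (\<exists>T. turnback_arc_set G T \<and>
      (\<exists>y \<in> int_vecs G. (\<forall>v \<in> verts G. y v \<ge> 0) \<and>
        lin_equiv G x (\<lambda>v. indegree_vec G T v + y v)))"
proof -
  interpret fin_digraph G by fact
  interpret loopfree_digraph G by fact
  interpret connected_eulerian_digraph G
    using assms by unfold_locales
  show ?thesis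
  proof
    assume "non_terminating G x"
    moreover have "legal_game G [x] \<and> hd [x] = x" using assms(5) by (simp add: legal_game_def)
    ultimately obtain f where f: "infinite_legal_game G f" "\<forall>i<length [x]. f i = [x] ! i"
      unfolding non_terminating_def by blast
    then have "f 0 = x" by simp
    with f(1) show "\<exists>T. turnback_arc_set G T \<and> (\<exists>y \<in> int_vecs G. (\<forall>v \<in> verts G. y v \<ge> 0) \<and>
        lin_equiv G x (\<lambda>v. indegree_vec G T v + y v))"
      using infinite_game_imp_above_turnback by blast
  next
    assume "\<exists>T. turnback_arc_set G T \<and> (\<exists>y \<in> int_vecs G. (\<forall>v \<in> verts G. y v \<ge> 0) \<and>
        lin_equiv G x (\<lambda>v. indegree_vec G T v + y v))"
    then obtain T y where T: "turnback_arc_set G T" and y: "\<And>v. v \<in> verts G \<Longrightarrow> y v \<ge> 0"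
      and x: "lin_equiv G x (\<lambda>v. indegree_vec G T v + y v)"
      by blast
    show "non_terminating G x"
    proof (rule non_terminating_if_all_active[OF assms(5)])
      fix x' assume "lin_equiv G x' x"
      then have "lin_equiv G x' (\<lambda>v. indegree_vec G T v + y v)"
        using x by (rule lin_equiv_trans)
      with T y show "\<exists>v. active G x' v"
        by (rule active_if_equiv_above_turnback)
    qed
  qed
qed

end
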